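(* Let $(R,M)$ be a commutative Noetherian local ring and let $N$ be a finitely generated $R$-module. Then $$\mathrm{depth}\, N\le \mathrm{indim}\, N,$$ and equality holds if and only if $N$ is initially Cohen--Macaulay.
   Context: For a prime ideal $P$ of $R$, the coheight is $\mathrm{coht}\,P=\dim R/P$. The initial dimension of an $R$-module $N$ is $\mathrm{indim}\,N=\inf\{\mathrm{coht}\,P\mid P\in\mathrm{Ass}_R N\}$. For a local ring $(R,M)$, $\mathrm{depth}\,N$ is the length of a maximal $N$-regular sequence in $M$. A finitely generated $R$-module $N$ is initially Cohen--Macaulay if $N=0$ or $\mathrm{depth}\,N=\mathrm{indim}\,N$. *)

theory Defs
  imports "HOL-Algebra.Algebra" "HOL-Library.Extended_Nat"
begin

definition local_ring :: "('a, 'r) ring_scheme \<Rightarrow> 'a set \<Rightarrow> bool" where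
  "local_ring R M \<longleftrightarrow>
     cring R \<and> maximalideal M R \<and> (\<forall>J. maximalideal J R \<longrightarrow> J = M)"

subsection \<open>Modules\<close>

definition gen_submodule ::
  "('a, 'r) ring_scheme \<Rightarrow> ('a, 'b, 'm) module_scheme \<Rightarrow> 'b set \<Rightarrow> 'b set" where
  "gen_submodule R N S = \<Inter>{H. submodule H R N \<and> S \<subseteq> H}"

definition fg_module :: "('a, 'r) ring_scheme \<Rightarrow> ('a, 'b, 'm) module_scheme \<Rightarrow> bool" where
  "fg_module R N \<longleftrightarrow>
     (\<exists>A. finite A \<and> A \<subseteq> carrier N \<and> carrier N = gen_submodule R N A)"

definition zero_module :: "('a, 'b, 'm) module_scheme \<Rightarrow> bool" where
  "zero_module N \<longleftrightarrow> carrier N = {\<zero>\<^bsub>N\<^esub>}"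

text \<open>The fields \<open>mult\<close> and \<open>one\<close>, which \<^locale>\<open>module\<close> ignores, are left unspecified.\<close>

definition quot_module ::
  "('a, 'b, 'm) module_scheme \<Rightarrow> 'b set \<Rightarrow> ('a, 'b set) module" where
  "quot_module N H =
     \<lparr>carrier = a_rcosets\<^bsub>N\<^esub> H, monoid.mult = undefined, one = undefined,
      ring.zero = H, add = set_add N,
      smult = (\<lambda>a C. \<Union>x\<in>C. H +>\<^bsub>N\<^esub> (a \<odot>\<^bsub>N\<^esub> x))\<rparr>"

definition ideal_smult ::
  "('a, 'r) ring_scheme \<Rightarrow> ('a, 'b, 'm) module_scheme \<Rightarrow> 'a set \<Rightarrow> 'b set" where
  "ideal_smult R N I = gen_submodule R N {a \<odot>\<^bsub>N\<^esub> x | a x. a \<in> I \<and> x \<in> carrier N}"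

subsection \<open>Depth\<close>

definition module_nonzerodivisor :: "('a, 'b, 'm) module_scheme \<Rightarrow> 'a \<Rightarrow> bool" where
  "module_nonzerodivisor N a \<longleftrightarrow>
     (\<forall>x\<in>carrier N. a \<odot>\<^bsub>N\<^esub> x = \<zero>\<^bsub>N\<^esub> \<longrightarrow> x = \<zero>\<^bsub>N\<^esub>)"

definition regular_sequence ::
  "('a, 'r) ring_scheme \<Rightarrow> ('a, 'b, 'm) module_scheme \<Rightarrow> 'a list \<Rightarrow> bool" where
  "regular_sequence R N xs \<longleftrightarrow>
     set xs \<subseteq> carrier R \<and>
     (\<forall>i<length xs. module_nonzerodivisor
        (quot_module N (ideal_smult R N (Idl\<^bsub>R\<^esub> (set (take i xs))))) (xs ! i)) \<and>
     \<not> zero_module (quot_module N (ideal_smult R N (Idl\<^bsub>R\<^esub> (set xs))))"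

text \<open>
  The length of a longest \<open>N\<close>-regular sequence in the ideal \<open>M\<close>.  The zero module has no
  regular sequence; its depth is \<open>\<infinity>\<close> by the usual convention, in accordance with
  \<open>Inf {} = \<infinity>\<close> in the definition of \<open>indim\<close> below.
\<close>

definition depth ::
  "('a, 'r) ring_scheme \<Rightarrow> 'a set \<Rightarrow> ('a, 'b, 'm) module_scheme \<Rightarrow> enat" where
  "depth R M N =
     (if zero_module N then \<infinity>
      else Sup {enat (length xs) | xs. set xs \<subseteq> M \<and> regular_sequence R N xs})"

subsection \<open>Initial dimension\<close>

text \<open>
  Krull dimension.  The zero ring, which has no prime ideals, would get the value 0;
  below the dimension is only taken of quotients by prime ideals.
\<close>

definition krull_dim :: "('a, 'r) ring_scheme \<Rightarrow> enat" where
  "krull_dim R =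
     Sup {enat n | n. \<exists>P :: nat \<Rightarrow> 'a set.
       (\<forall>i\<le>n. primeideal (P i) R) \<and> (\<forall>i<n. P i \<subset> P (Suc i))}"

definition coht :: "('a, 'r) ring_scheme \<Rightarrow> 'a set \<Rightarrow> enat" where
  "coht R P = krull_dim (R Quot P)"

definition Ass :: "('a, 'r) ring_scheme \<Rightarrow> ('a, 'b, 'm) module_scheme \<Rightarrow> 'a set set" where
  "Ass R N = {P. primeideal P R \<and>
     (\<exists>x\<in>carrier N. P = {a \<in> carrier R. a \<odot>\<^bsub>N\<^esub> x = \<zero>\<^bsub>N\<^esub>})}"

definition indim :: "('a, 'r) ring_scheme \<Rightarrow> ('a, 'b, 'm) module_scheme \<Rightarrow> enat" where
  "indim R N = Inf {coht R P | P. P \<in> Ass R N}"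

definition initially_Cohen_Macaulay ::
  "('a, 'r) ring_scheme \<Rightarrow> 'a set \<Rightarrow> ('a, 'b, 'm) module_scheme \<Rightarrow> bool" where
  "initially_Cohen_Macaulay R M N \<longleftrightarrow> zero_module N \<or> depth R M N = indim R N"

end

theory Submission
  imports Defs
begin

text \<open>
  Along a regular sequence \<open>x\<^sub>1, \<dots>, x\<^sub>n\<close> on \<open>N\<close> an associated prime \<open>P\<close> of \<open>N\<close> grows to a strictly
  larger associated prime of \<open>N/x\<^sub>1N\<close>, then of \<open>N/(x\<^sub>1, x\<^sub>2)N\<close>, and so on; these primes form a
  chain of length \<open>n\<close> above \<open>P\<close>, so \<open>n \<le> dim R/P\<close>.  The primes are written as colon ideals
  \<open>(H : x)\<close> for submodules \<open>H\<close> of \<open>N\<close>, so that only submodules of the fixed module \<open>N\<close> occur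
  and no iterated quotient modules.
\<close>

section \<open>Rings and quotients\<close>

text \<open>Negatives are products with \<open>-1\<close>, and commutativity turns absorption on one
  side into absorption on both.\<close>

lemma (in cring) idealI_closed:
  assumes "I \<subseteq> carrier R" "\<zero> \<in> I"
    and add: "\<And>a b. \<lbrakk>a \<in> I; b \<in> I\<rbrakk> \<Longrightarrow> a \<oplus> b \<in> I"
    and mult: "\<And>a b. \<lbrakk>a \<in> carrier R; b \<in> I\<rbrakk> \<Longrightarrow> a \<otimes> b \<in> I"
  shows "ideal I R"
proof (rule idealI)
  have neg: "\<ominus> a \<in> I" if "a \<in> I" for a
    using mult[of "\<ominus> \<one>" a] that assms(1) by (auto simp: l_minus)
  show "subgroup I (add_monoid R)"
    by (rule add.subgroupI) (use assms(1,2) add neg in \<open>auto simp: a_inv_def\<close>)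
  show "a \<otimes> b \<in> I" if "a \<in> I" "b \<in> carrier R" for a b
    using mult[OF that(2,1)] that assms(1) m_comm by (metis subsetD)
qed (use mult ring_axioms in auto)

text \<open>Since \<open>Q\<close> contains \<open>I\<close>, a coset \<open>I + x\<close> lies in
  the image of \<open>Q\<close> exactly when \<open>x\<close> lies in \<open>Q\<close>. Properness
  and primality therefore transfer from \<open>Q\<close> to its image.\<close>

lemma (in cring) primeideal_image_quotient:
  assumes "ideal I R" "I \<subseteq> Q" "primeideal Q R"
  shows "primeideal ((+>) I ` Q) (R Quot I)"
proof -
  interpret I: ideal I R by fact
  interpret Q: primeideal Q R by fact
  have mem: "I +> x \<in> (+>) I ` Q \<longleftrightarrow> x \<in> Q" if "x \<in> carrier R" for x
  proof
    assume "I +> x \<in> (+>) I ` Q"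
    then obtain q where q: "q \<in> Q" "I +> x = I +> q" by blast
    then have "x \<in> I +> q" using I.a_rcos_self[OF that] by simp
    then obtain i where "i \<in> I" "x = i \<oplus> q" by (auto simp: a_r_coset_def')
    then show "x \<in> Q" using q assms(2) by auto
  qed simp
  have carr: "carrier (R Quot I) = (+>) I ` carrier R"
    by (auto simp: FactRing_def A_RCOSETS_def')
  have mult: "(I +> x) \<otimes>\<^bsub>R Quot I\<^esub> (I +> y) = I +> (x \<otimes> y)"
    if "x \<in> carrier R" "y \<in> carrier R" for x y
    using I.rcoset_mult_add[OF that] by (simp add: FactRing_def)
  show ?thesis
  proof (rule primeidealI)
    show "ideal ((+>) I ` Q) (R Quot I)"
      using ring_ideal_imp_quot_ideal assms(1) Q.is_ideal by blast
    show "cring (R Quot I)"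
      using I.quotient_is_cring is_cring by blast
    obtain x where "x \<in> carrier R" "x \<notin> Q" using Q.I_notcarr Q.a_subset by blast
    then have "I +> x \<in> carrier (R Quot I)" "I +> x \<notin> (+>) I ` Q"
      using mem[of x] carr by auto
    then show "carrier (R Quot I) \<noteq> (+>) I ` Q" by metis
    fix a b
    assume "a \<in> carrier (R Quot I)" "b \<in> carrier (R Quot I)"
      and ab: "a \<otimes>\<^bsub>R Quot I\<^esub> b \<in> (+>) I ` Q"
    then obtain x y where xy: "x \<in> carrier R" "y \<in> carrier R" "a = I +> x" "b = I +> y"
      unfolding carr by blast
    then have "x \<otimes> y \<in> Q" using ab mult mem by simp
    then show "a \<in> (+>) I ` Q \<or> b \<in> (+>) I ` Q"
      using Q.I_prime[OF xy(1,2)] xy(3,4) by auto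
  qed
qed

text \<open>The correspondence between ideals above \<open>P 0\<close> and ideals of the quotient is
  injective, so the images of the \<open>P i\<close> still form a strict chain of primes. This chain
  is one of those over which \<open>krull_dim\<close> takes the supremum.\<close>

lemma (in cring) coht_ge_chain_length:
  assumes prime: "\<And>i. i \<le> n \<Longrightarrow> primeideal (P i) R"
    and strict: "\<And>i. i < n \<Longrightarrow> P i \<subset> P (Suc i)"
  shows "enat n \<le> coht R (P 0)"
proof -
  have P0: "ideal (P 0) R" using prime[of 0] primeideal.axioms(1) by blast
  have sub: "P 0 \<subseteq> P i" if "i \<le> n" for i
    using that by (induction i) (use strict in \<open>auto simp: Suc_le_eq\<close>)
  let ?f = "(`) ((+>) (P 0))"
  have inj: "inj_on ?f {J. ideal J R \<and> P 0 \<subseteq> J}"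
    using quot_ideal_correspondence[OF P0] by (rule bij_betw_imp_inj_on)
  have "?f (P i) \<subset> ?f (P (Suc i))" if "i < n" for i
  proof -
    have "?f (P i) \<noteq> ?f (P (Suc i))"
      using inj_onD[OF inj, of "P i" "P (Suc i)"] strict[OF that] sub[of i] sub[of "Suc i"]
        prime[of i] prime[of "Suc i"] that primeideal.axioms(1)
      by fastforce
    then show ?thesis using strict[OF that] by blast
  qed
  moreover have "primeideal (?f (P i)) (R Quot P 0)" if "i \<le> n" for i
    using primeideal_image_quotient[OF P0 sub prime] that by blast
  ultimately show ?thesis
    unfolding coht_def krull_dim_def
    by (intro Sup_upper CollectI exI[of _ n] conjI exI[of _ "\<lambda>i. ?f (P i)"]) auto
qed

section \<open>Noetherian rings and units of a local ring\<close>

text \<open>Zorn's lemma applies because in a Noetherian ring a nonempty chain of ideals contains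
  its own union.\<close>

lemma (in noetherian_ring) exists_maximal_ideal_in:
  assumes "S \<noteq> {}" and "\<And>I. I \<in> S \<Longrightarrow> ideal I R"
  shows "\<exists>I\<in>S. \<forall>J\<in>S. I \<subseteq> J \<longrightarrow> J = I"
proof (rule subset_Zorn_nonempty[OF assms(1)])
  fix C assume C: "C \<noteq> {}" "subset.chain S C"
  then have "subset.chain {I. ideal I R} C"
    using assms(2) by (auto simp: pred_on.chain_def)
  then have "\<Union>C \<in> C"
    by (rule ideal_chain_is_trivial[OF C(1)])
  then show "\<Union>C \<in> S"
    using C(2) by (auto simp: pred_on.chain_def)
qed

lemma (in noetherian_ring) ascending_ideals_stabilize:
  fixes I :: "nat \<Rightarrow> 'a set"
  assumes "\<And>n. ideal (I n) R" and "mono I"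
  shows "\<exists>n. \<forall>m\<ge>n. I m = I n"
proof -
  have "\<exists>J\<in>range I. \<forall>K\<in>range I. J \<subseteq> K \<longrightarrow> K = J"
    by (rule exists_maximal_ideal_in) (use assms(1) in auto)
  then obtain n where n: "\<And>m. I n \<subseteq> I m \<Longrightarrow> I m = I n" by auto
  then have "I m = I n" if "m \<ge> n" for m
    using monoD[OF assms(2) that] by simp
  then show ?thesis by auto
qed

lemma (in noetherian_ring) proper_ideal_in_maximalideal:
  assumes "ideal I R" and "I \<noteq> carrier R"
  shows "\<exists>J. maximalideal J R \<and> I \<subseteq> J"
proof -
  let ?S = "{J. ideal J R \<and> I \<subseteq> J \<and> J \<noteq> carrier R}"
  have "\<exists>J\<in>?S. \<forall>K\<in>?S. J \<subseteq> K \<longrightarrow> K = J"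
    by (rule exists_maximal_ideal_in) (use assms in auto)
  then obtain J where J: "J \<in> ?S" and max: "\<forall>K\<in>?S. J \<subseteq> K \<longrightarrow> K = J" by meson
  have "maximalideal J R"
  proof (rule maximalidealI)
    show "ideal J R" "carrier R \<noteq> J" using J by auto
    show "K = J \<or> K = carrier R" if "ideal K R" "J \<subseteq> K" "K \<subseteq> carrier R" for K
    proof (rule disjCI)
      assume "K \<noteq> carrier R"
      with that(1,2) J have "K \<in> ?S" by auto
      with max that(2) show "K = J" by meson
    qed
  qed
  with J show ?thesis by auto
qed

text \<open>If \<open>1 - a\<close> were not a unit, the ideal it generates would be proper and
  hence contained in the only maximal ideal \<open>M\<close>. Then \<open>1 = (1 - a) + a\<close>
  would lie in \<open>M\<close>.\<close>

lemma (in noetherian_ring) local_ring_one_minus_Units: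
  assumes "local_ring R M" and "a \<in> M"
  shows "\<one> \<ominus> a \<in> Units R"
proof (rule ccontr)
  interpret cring R using assms(1) unfolding local_ring_def by blast
  interpret M: maximalideal M R using assms(1) unfolding local_ring_def by blast
  have a: "a \<in> carrier R" using assms(2) by simp
  define u where "u = \<one> \<ominus> a"
  have u: "u \<in> carrier R" using a unfolding u_def by simp
  assume "\<one> \<ominus> a \<notin> Units R"
  moreover have "u \<in> Units R" if "PIdl u = carrier R"
  proof -
    have "\<one> \<in> PIdl u" using that by simp
    then obtain v where "v \<in> carrier R" "\<one> = v \<otimes> u"
      unfolding cgenideal_def by blast
    then show ?thesis
      using u m_comm[OF u] unfolding Units_def by auto
  qed
  ultimately have "PIdl u \<noteq> carrier R" unfolding u_def by blast
  then obtain J where J: "maximalideal J R" "PIdl u \<subseteq> J"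
    using proper_ideal_in_maximalideal[OF cgenideal_ideal[OF u]] by blast
  then have "J = M" using assms(1) unfolding local_ring_def by blast
  then have "u \<in> M" using J cgenideal_self[OF u] by blast
  then have "u \<oplus> a \<in> M" using assms(2) by simp
  moreover have "u \<oplus> a = \<one>" unfolding u_def using a by algebra
  ultimately show False
    using M.one_imp_carrier M.I_notcarr by auto
qed

section \<open>Submodules\<close>

text \<open>For a submodule \<open>H\<close> this is the annihilator of the class of
  \<open>x\<close> in the quotient of \<open>N\<close> by \<open>H\<close>. The associated primes of
  that quotient are thus the prime ideals of this form, and \<open>H = 0\<close> gives those of
  \<open>N\<close>.\<close>

definition colon ::
  "('a, 'r) ring_scheme \<Rightarrow> ('a, 'b, 'm) module_scheme \<Rightarrow> 'b set \<Rightarrow> 'b \<Rightarrow> 'a set" where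
  "colon R N H x = {a \<in> carrier R. a \<odot>\<^bsub>N\<^esub> x \<in> H}"

context module
begin

section \<open>Cyclic submodules, images, sums and generated submodules\<close>

lemma submodule_zero: "submodule {\<zero>\<^bsub>M\<^esub>} R M"
  by (rule submoduleI) auto

lemma submodule_zero_closed: "submodule H R M \<Longrightarrow> \<zero>\<^bsub>M\<^esub> \<in> H"
  using submoduleE(1,2,4)[of H] R.zero_closed smult_l_null by (metis ex_in_conv subsetD)

lemma submodule_minus_closed:
  assumes "submodule H R M" "x \<in> H" "y \<in> H"
  shows "x \<ominus>\<^bsub>M\<^esub> y \<in> H"
  using submoduleE(3,5)[OF assms(1)] assms(2,3) by (simp add: a_minus_def)

lemma submodule_cyclic:
  assumes "x \<in> carrier M"
  shows "submodule {r \<odot>\<^bsub>M\<^esub> x | r. r \<in> carrier R} R M" (is "submodule ?C R M")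
proof (rule submoduleI)
  have C: "r \<odot>\<^bsub>M\<^esub> x \<in> ?C" if "r \<in> carrier R" for r using that by auto
  show "\<zero>\<^bsub>M\<^esub> \<in> ?C"
    using C[OF R.zero_closed] assms by simp
  show "\<ominus>\<^bsub>M\<^esub> y \<in> ?C" if "y \<in> ?C" for y
  proof -
    from that obtain r where "r \<in> carrier R" "y = r \<odot>\<^bsub>M\<^esub> x" by auto
    then show ?thesis using C[of "\<ominus> r"] assms by (simp add: smult_l_minus)
  qed
  show "y \<oplus>\<^bsub>M\<^esub> z \<in> ?C" if "y \<in> ?C" "z \<in> ?C" for y z
  proof -
    from that obtain r s
      where "r \<in> carrier R" "y = r \<odot>\<^bsub>M\<^esub> x" "s \<in> carrier R" "z = s \<odot>\<^bsub>M\<^esub> x" by auto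
    then show ?thesis using C[of "r \<oplus> s"] assms by (simp add: smult_l_distr)
  qed
  show "a \<odot>\<^bsub>M\<^esub> y \<in> ?C" if "a \<in> carrier R" "y \<in> ?C" for a y
  proof -
    from that obtain r where "r \<in> carrier R" "y = r \<odot>\<^bsub>M\<^esub> x" by auto
    then show ?thesis using C[of "a \<otimes> r"] that(1) assms by (simp add: smult_assoc1)
  qed
qed (use assms in auto)

lemma smult_left_commute:
  "\<lbrakk>a \<in> carrier R; b \<in> carrier R; x \<in> carrier M\<rbrakk> \<Longrightarrow>
    a \<odot>\<^bsub>M\<^esub> (b \<odot>\<^bsub>M\<^esub> x) = b \<odot>\<^bsub>M\<^esub> (a \<odot>\<^bsub>M\<^esub> x)"
  using smult_assoc1 R.m_comm by metis

lemma submodule_smult_image: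
  assumes "a \<in> carrier R"
  shows "submodule ((\<odot>\<^bsub>M\<^esub>) a ` carrier M) R M" (is "submodule ?A R M")
proof (rule submoduleI)
  have A: "a \<odot>\<^bsub>M\<^esub> x \<in> ?A" if "x \<in> carrier M" for x using that by auto
  show "\<zero>\<^bsub>M\<^esub> \<in> ?A"
    using A[OF M.zero_closed] assms by simp
  show "\<ominus>\<^bsub>M\<^esub> y \<in> ?A" if "y \<in> ?A" for y
  proof -
    from that obtain x where "x \<in> carrier M" "y = a \<odot>\<^bsub>M\<^esub> x" by auto
    then show ?thesis using A[of "\<ominus>\<^bsub>M\<^esub> x"] assms by (simp add: smult_r_minus)
  qed
  show "y \<oplus>\<^bsub>M\<^esub> z \<in> ?A" if "y \<in> ?A" "z \<in> ?A" for y z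
  proof -
    from that obtain v w
      where "v \<in> carrier M" "y = a \<odot>\<^bsub>M\<^esub> v" "w \<in> carrier M" "z = a \<odot>\<^bsub>M\<^esub> w" by auto
    then show ?thesis using A[of "v \<oplus>\<^bsub>M\<^esub> w"] assms by (simp add: smult_r_distr)
  qed
  show "b \<odot>\<^bsub>M\<^esub> y \<in> ?A" if "b \<in> carrier R" "y \<in> ?A" for b y
  proof -
    from that obtain x where "x \<in> carrier M" "y = a \<odot>\<^bsub>M\<^esub> x" by auto
    then show ?thesis
      using A[of "b \<odot>\<^bsub>M\<^esub> x"] that(1) assms by (simp add: smult_left_commute[of b a])
  qed
qed (use assms in auto)

lemma mem_set_add_iff: "x \<in> H <+>\<^bsub>M\<^esub> K \<longleftrightarrow> (\<exists>h\<in>H. \<exists>k\<in>K. x = h \<oplus>\<^bsub>M\<^esub> k)"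
  by (auto simp: set_add_def')

lemma submodule_set_add:
  assumes "submodule H R M" "submodule K R M"
  shows "submodule (H <+>\<^bsub>M\<^esub> K) R M"
proof (rule submoduleI)
  note H = submoduleE[OF assms(1)] and K = submoduleE[OF assms(2)]
  have carr: "h \<in> H \<Longrightarrow> h \<in> carrier M" "k \<in> K \<Longrightarrow> k \<in> carrier M" for h k
    using H(1) K(1) by auto
  show "H <+>\<^bsub>M\<^esub> K \<subseteq> carrier M"
    by (auto simp: mem_set_add_iff carr)
  show "\<zero>\<^bsub>M\<^esub> \<in> H <+>\<^bsub>M\<^esub> K"
    using assms[THEN submodule_zero_closed] unfolding mem_set_add_iff by force
  fix x assume "x \<in> H <+>\<^bsub>M\<^esub> K"
  then obtain h k where hk: "h \<in> H" "k \<in> K" "x = h \<oplus>\<^bsub>M\<^esub> k"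
    by (auto simp: mem_set_add_iff)
  then have "\<ominus>\<^bsub>M\<^esub> x = (\<ominus>\<^bsub>M\<^esub> h) \<oplus>\<^bsub>M\<^esub> (\<ominus>\<^bsub>M\<^esub> k)"
    by (simp add: carr M.minus_add)
  then show "\<ominus>\<^bsub>M\<^esub> x \<in> H <+>\<^bsub>M\<^esub> K"
    using H(3) K(3) hk unfolding mem_set_add_iff by blast
  show "a \<odot>\<^bsub>M\<^esub> x \<in> H <+>\<^bsub>M\<^esub> K" if "a \<in> carrier R" for a
  proof -
    have "a \<odot>\<^bsub>M\<^esub> x = a \<odot>\<^bsub>M\<^esub> h \<oplus>\<^bsub>M\<^esub> a \<odot>\<^bsub>M\<^esub> k"
      using that hk by (simp add: carr smult_r_distr)
    then show ?thesis
      using H(4) K(4) hk that unfolding mem_set_add_iff by blast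
  qed
  fix y assume "y \<in> H <+>\<^bsub>M\<^esub> K"
  then obtain h' k' where hk': "h' \<in> H" "k' \<in> K" "y = h' \<oplus>\<^bsub>M\<^esub> k'"
    by (auto simp: mem_set_add_iff)
  have "x \<oplus>\<^bsub>M\<^esub> y = (h \<oplus>\<^bsub>M\<^esub> h') \<oplus>\<^bsub>M\<^esub> (k \<oplus>\<^bsub>M\<^esub> k')"
    using hk hk' by (simp add: carr M.a_ac)
  then show "x \<oplus>\<^bsub>M\<^esub> y \<in> H <+>\<^bsub>M\<^esub> K"
    using H(5) K(5) hk hk' unfolding mem_set_add_iff by blast
qed

lemma set_add_upper:
  assumes "submodule H R M" "submodule K R M"
  shows "H \<subseteq> H <+>\<^bsub>M\<^esub> K" and "K \<subseteq> H <+>\<^bsub>M\<^esub> K"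
proof -
  note z = assms[THEN submodule_zero_closed] and c = assms[THEN submoduleE(1)]
  show "H \<subseteq> H <+>\<^bsub>M\<^esub> K"
  proof
    fix h assume "h \<in> H"
    then have "h = h \<oplus>\<^bsub>M\<^esub> \<zero>\<^bsub>M\<^esub>" using c by auto
    with z \<open>h \<in> H\<close> show "h \<in> H <+>\<^bsub>M\<^esub> K" unfolding mem_set_add_iff by blast
  qed
  show "K \<subseteq> H <+>\<^bsub>M\<^esub> K"
  proof
    fix k assume "k \<in> K"
    then have "k = \<zero>\<^bsub>M\<^esub> \<oplus>\<^bsub>M\<^esub> k" using c by auto
    with z \<open>k \<in> K\<close> show "k \<in> H <+>\<^bsub>M\<^esub> K" unfolding mem_set_add_iff by blast
  qed
qed

lemma submodule_gen_submodule:
  assumes "S \<subseteq> carrier M"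
  shows "submodule (gen_submodule R M S) R M"
proof (rule submoduleI)
  let ?F = "{H. submodule H R M \<and> S \<subseteq> H}"
  have "carrier M \<in> ?F" using carrier_is_submodule assms by simp
  then show "gen_submodule R M S \<subseteq> carrier M"
    unfolding gen_submodule_def by blast
  show "\<zero>\<^bsub>M\<^esub> \<in> gen_submodule R M S"
    unfolding gen_submodule_def using submodule_zero_closed by blast
  show "\<ominus>\<^bsub>M\<^esub> a \<in> gen_submodule R M S" if "a \<in> gen_submodule R M S" for a
    using that submoduleE(3) unfolding gen_submodule_def by blast
  show "a \<oplus>\<^bsub>M\<^esub> b \<in> gen_submodule R M S"
    if "a \<in> gen_submodule R M S" "b \<in> gen_submodule R M S" for a b
    using that submoduleE(5) unfolding gen_submodule_def by blast
  show "a \<odot>\<^bsub>M\<^esub> b \<in> gen_submodule R M S"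
    if "a \<in> carrier R" "b \<in> gen_submodule R M S" for a b
    using that submoduleE(4) unfolding gen_submodule_def by blast
qed

lemma gen_submodule_minimal: "\<lbrakk>submodule H R M; S \<subseteq> H\<rbrakk> \<Longrightarrow> gen_submodule R M S \<subseteq> H"
  unfolding gen_submodule_def by blast

lemma gen_submodule_self: "S \<subseteq> gen_submodule R M S"
  unfolding gen_submodule_def by blast

section \<open>Colon ideals and associated primes\<close>

lemma mem_colon_iff: "a \<in> colon R M H x \<longleftrightarrow> a \<in> carrier R \<and> a \<odot>\<^bsub>M\<^esub> x \<in> H"
  by (simp add: colon_def)

lemma ideal_colon:
  assumes "submodule H R M" "x \<in> carrier M"
  shows "ideal (colon R M H x) R"
  using submoduleE[OF assms(1)] submodule_zero_closed[OF assms(1)] assms(2)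
  by (intro R.idealI_closed) (auto simp: mem_colon_iff smult_l_distr smult_assoc1)

text \<open>
  A colon ideal which is maximal among those of the multiples of \<open>x\<close> outside \<open>K\<close> is prime.
\<close>
lemma exists_prime_colon:
  assumes "noetherian_ring R" "submodule K R M" "x \<in> carrier M" "x \<notin> K"
  shows "\<exists>z\<in>carrier M. colon R M K x \<subseteq> colon R M K z \<and> primeideal (colon R M K z) R"
proof -
  interpret noetherian_ring R by fact
  note K = submoduleE[OF assms(2)]
  let ?S = "{colon R M K (r \<odot>\<^bsub>M\<^esub> x) | r. r \<in> carrier R \<and> r \<odot>\<^bsub>M\<^esub> x \<notin> K}"
  have "colon R M K (\<one> \<odot>\<^bsub>M\<^esub> x) \<in> ?S"
    using assms(3,4) R.one_closed by (metis (mono_tags, lifting) mem_Collect_eq smult_one)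
  then have "?S \<noteq> {}" by auto
  moreover have "ideal I R" if "I \<in> ?S" for I
    using that ideal_colon[OF assms(2)] assms(3) by auto
  ultimately have "\<exists>I\<in>?S. \<forall>J\<in>?S. I \<subseteq> J \<longrightarrow> J = I"
    by (rule exists_maximal_ideal_in)
  then obtain I where I: "I \<in> ?S" and max: "\<And>J. \<lbrakk>J \<in> ?S; I \<subseteq> J\<rbrakk> \<Longrightarrow> J = I" by meson
  then obtain r where r: "r \<in> carrier R" "r \<odot>\<^bsub>M\<^esub> x \<notin> K" "I = colon R M K (r \<odot>\<^bsub>M\<^esub> x)"
    by blast
  define z where "z = r \<odot>\<^bsub>M\<^esub> x"
  have z: "z \<in> carrier M" "z \<notin> K" "I = colon R M K z"
    using r assms(3) unfolding z_def by auto
  have "primeideal I R"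
  proof (rule primeidealI)
    show "ideal I R" using ideal_colon[OF assms(2) z(1)] z(3) by simp
    show "cring R" by (rule R.is_cring)
    have "\<one> \<notin> I" using z by (simp add: mem_colon_iff)
    then show "carrier R \<noteq> I" by auto
    fix a b assume ab: "a \<in> carrier R" "b \<in> carrier R" "a \<otimes> b \<in> I"
    show "a \<in> I \<or> b \<in> I"
    proof (rule disjCI)
      assume "b \<notin> I"
      \<comment> \<open>As \<open>bz\<close> is a multiple of \<open>x\<close> outside
        \<open>K\<close>, its colon ideal competes with \<open>I\<close>. It contains
        \<open>I\<close>, so it equals \<open>I\<close> by maximality, and \<open>ab\<close> in
        \<open>I\<close> says that \<open>a\<close> belongs to it.\<close>
      then have "(b \<otimes> r) \<odot>\<^bsub>M\<^esub> x \<notin> K"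
        using ab r z assms(3) by (simp add: mem_colon_iff smult_assoc1)
      then have inS: "colon R M K ((b \<otimes> r) \<odot>\<^bsub>M\<^esub> x) \<in> ?S"
        using ab r by blast
      have bz: "(b \<otimes> r) \<odot>\<^bsub>M\<^esub> x = b \<odot>\<^bsub>M\<^esub> z"
        using ab r assms(3) by (simp add: z_def smult_assoc1)
      have "I \<subseteq> colon R M K (b \<odot>\<^bsub>M\<^esub> z)"
        using z ab K(4) by (auto simp: mem_colon_iff smult_left_commute[of _ b])
      with max[OF inS[unfolded bz]] have "colon R M K (b \<odot>\<^bsub>M\<^esub> z) = I" .
      then show "a \<in> I"
        using ab z by (auto simp: mem_colon_iff smult_assoc1)
    qed
  qed
  moreover have "colon R M K x \<subseteq> I"
    using z(3) r(1) assms(3) K(4) by (auto simp: mem_colon_iff z_def smult_left_commute[of _ r])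
  ultimately show ?thesis using z by blast
qed

section \<open>Ascending chains of submodules\<close>

lemma gen_submodule_insert_subset:
  assumes "A \<subseteq> carrier M" "x \<in> carrier M"
  shows "gen_submodule R M (insert x A) \<subseteq>
    gen_submodule R M A <+>\<^bsub>M\<^esub> {r \<odot>\<^bsub>M\<^esub> x | r. r \<in> carrier R}"
proof (rule gen_submodule_minimal)
  let ?K = "{r \<odot>\<^bsub>M\<^esub> x | r. r \<in> carrier R}"
  note sub = submodule_gen_submodule[OF assms(1)] submodule_cyclic[OF assms(2)]
  show "submodule (gen_submodule R M A <+>\<^bsub>M\<^esub> ?K) R M"
    using submodule_set_add sub by blast
  have "x \<in> ?K"
    using assms(2) smult_one R.one_closed by (metis (mono_tags, lifting) mem_Collect_eq)
  then show "insert x A \<subseteq> gen_submodule R M A <+>\<^bsub>M\<^esub> ?K"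
    using set_add_upper[OF sub] gen_submodule_self by blast
qed

text \<open>Induction on the generators. Splitting off a generator \<open>x\<close>, the chain
  \<open>C\<close> is controlled by its intersection with the span of the others, covered by the
  induction hypothesis, and by an ascending chain of ideals of coefficients of \<open>x\<close>.
  Where both are stationary, so is \<open>C\<close>.\<close>

lemma ascending_submodules_of_gen_stabilize:
  assumes "noetherian_ring R" "finite A" "A \<subseteq> carrier M"
    and "\<And>n. submodule (C n) R M" "mono C" "\<And>n. C n \<subseteq> gen_submodule R M A"
  shows "\<exists>n::nat. \<forall>m\<ge>n. C m = C n"
  using assms(2-)
proof (induction A arbitrary: C rule: finite_induct)
  case empty
  have "C n = {\<zero>\<^bsub>M\<^esub>}" for n
    using empty.prems(4) gen_submodule_minimal[OF submodule_zero, of "{}"]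
      submodule_zero_closed[OF empty.prems(2)] by blast
  then show ?case by simp
next
  case (insert x A)
  interpret noetherian_ring R by fact
  have A: "A \<subseteq> carrier M" "x \<in> carrier M" using insert.prems(1) by auto
  let ?G = "gen_submodule R M A"
  note G = submodule_gen_submodule[OF A(1)]
  note GE = submoduleE[OF G] and CE = submoduleE[OF insert.prems(2)]
  have Gc: "h \<in> ?G \<Longrightarrow> h \<in> carrier M" for h using GE(1) by blast
  have Cc: "h \<in> C n \<Longrightarrow> h \<in> carrier M" for h n using CE(1) by blast
  have "submodule (C n \<inter> ?G) R M" for n
    using submodule_zero_closed[OF G] submodule_zero_closed[OF insert.prems(2)] GE CE
    by (intro submoduleI) auto
  moreover have "mono (\<lambda>n. C n \<inter> ?G)"
    using insert.prems(3) by (auto simp: mono_def)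
  ultimately obtain n1 where n1: "\<And>m. m \<ge> n1 \<Longrightarrow> C m \<inter> ?G = C n1 \<inter> ?G"
    using insert.IH[OF A(1), of "\<lambda>n. C n \<inter> ?G"] by blast
  \<comment> \<open>\<open>J n\<close> consists of the coefficients \<open>r\<close> for which some
    \<open>g + rx\<close> with \<open>g\<close> in \<open>?G\<close> lies in
    \<open>C n\<close>.\<close>
  define J where "J n = colon R M (?G <+>\<^bsub>M\<^esub> C n) x" for n
  have "ideal (J n) R" for n
    unfolding J_def using ideal_colon submodule_set_add[OF G insert.prems(2)] A(2) by blast
  moreover have "mono J"
    using insert.prems(3) unfolding J_def mono_def
    by (auto simp: mem_colon_iff mem_set_add_iff) blast
  ultimately obtain n2 where n2: "\<And>m. m \<ge> n2 \<Longrightarrow> J m = J n2"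
    using ascending_ideals_stabilize by blast
  define n where "n = max n1 n2"
  have "C m \<subseteq> C n" if "m \<ge> n" for m
  proof
    fix y assume y: "y \<in> C m"
    have "y \<in> ?G <+>\<^bsub>M\<^esub> {r \<odot>\<^bsub>M\<^esub> x | r. r \<in> carrier R}"
      using gen_submodule_insert_subset[OF A] insert.prems(4) y by blast
    then obtain g r where gr: "g \<in> ?G" "r \<in> carrier R" "y = g \<oplus>\<^bsub>M\<^esub> r \<odot>\<^bsub>M\<^esub> x"
      unfolding mem_set_add_iff by blast
    have rx: "r \<odot>\<^bsub>M\<^esub> x \<in> carrier M" using gr A by simp
    have "r \<odot>\<^bsub>M\<^esub> x = \<ominus>\<^bsub>M\<^esub> g \<oplus>\<^bsub>M\<^esub> y"
      using gr Gc rx by (simp add: M.r_neg1)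
    then have "r \<in> J m"
      using gr y GE(3) unfolding J_def mem_colon_iff mem_set_add_iff by blast
    then have "r \<in> J n" using n2 that unfolding n_def by (metis max.bounded_iff order_refl)
    \<comment> \<open>The element \<open>c\<close> of \<open>C n\<close> has the same coefficient of
      \<open>x\<close> as \<open>y\<close>. The difference \<open>y - c = g + g'\<close> is
      therefore in \<open>?G\<close> as well as in \<open>C m\<close>, and the stationary
      intersection puts it into \<open>C n\<close>.\<close>
    then obtain g' c where gc: "g' \<in> ?G" "c \<in> C n" "r \<odot>\<^bsub>M\<^esub> x = g' \<oplus>\<^bsub>M\<^esub> c"
      unfolding J_def mem_colon_iff mem_set_add_iff by blast
    have cm: "c \<in> C m" using gc monoD[OF insert.prems(3) that] by blast
    have yc: "y = (g \<oplus>\<^bsub>M\<^esub> g') \<oplus>\<^bsub>M\<^esub> c"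
      using gr gc Gc Cc by (simp add: M.a_assoc)
    then have "y \<ominus>\<^bsub>M\<^esub> c = g \<oplus>\<^bsub>M\<^esub> g'"
      using gr gc Gc Cc by (simp add: a_minus_def M.a_assoc M.r_neg)
    moreover have "y \<ominus>\<^bsub>M\<^esub> c \<in> C m"
      using submodule_minus_closed[OF insert.prems(2) y cm] .
    ultimately have "g \<oplus>\<^bsub>M\<^esub> g' \<in> C m \<inter> ?G"
      using GE(5) gr gc by auto
    then have "g \<oplus>\<^bsub>M\<^esub> g' \<in> C n"
      using n1[of m] n1[of n] that unfolding n_def by auto
    then show "y \<in> C n" using CE(5) gc yc by blast
  qed
  then show ?case using monoD[OF insert.prems(3)] by blast
qed

lemma fg_module_ascending_submodules_stabilize:
  assumes "noetherian_ring R" "fg_module R M" "\<And>n. submodule (C n) R M" "mono C"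
  shows "\<exists>n::nat. \<forall>m\<ge>n. C m = C n"
proof -
  obtain A where "finite A" "A \<subseteq> carrier M" "carrier M = gen_submodule R M A"
    using assms(2) unfolding fg_module_def by blast
  then show ?thesis
    using ascending_submodules_of_gen_stabilize[OF assms(1), of A C] assms(3,4) submoduleE(1)
    by auto
qed

section \<open>Division by a regular element and the step to a larger prime\<close>

text \<open>
  The case \<open>W = aW\<close> modulo \<open>H\<close> of Nakayama's lemma.  Dividing \<open>w \<in> W\<close> by \<open>a\<close> again and again
  gives an ascending chain of submodules \<open>H + R w\<^sub>i\<close>; where it becomes stationary,
  \<open>(1 - r a) w\<^sub>i \<in> H\<close> for some \<open>r\<close>.
\<close>
lemma divisible_subset_submodule:
  assumes "noetherian_ring R" "fg_module R M" "submodule H R M" "a \<in> carrier R"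
    and unit: "\<And>r. r \<in> carrier R \<Longrightarrow> \<one> \<ominus> r \<otimes> a \<in> Units R"
    and W: "W \<subseteq> carrier M"
    and div: "\<And>w. w \<in> W \<Longrightarrow> \<exists>h\<in>H. \<exists>v\<in>W. w = h \<oplus>\<^bsub>M\<^esub> a \<odot>\<^bsub>M\<^esub> v"
  shows "W \<subseteq> H"
proof
  fix w assume "w \<in> W"
  note H = submoduleE[OF assms(3)]
  have Hc: "h \<in> H \<Longrightarrow> h \<in> carrier M" for h using H(1) by blast
  \<comment> \<open>\<open>u 0 = w\<close>, and \<open>u (Suc n)\<close> is a chosen quotient of
    \<open>u n\<close> by \<open>a\<close> modulo \<open>H\<close> that stays in
    \<open>W\<close>.\<close>
  define u where "u = rec_nat w (\<lambda>_ w. SOME v. v \<in> W \<and> (\<exists>h\<in>H. w = h \<oplus>\<^bsub>M\<^esub> a \<odot>\<^bsub>M\<^esub> v))"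
  have u_Suc: "u (Suc n) \<in> W \<and> (\<exists>h\<in>H. u n = h \<oplus>\<^bsub>M\<^esub> a \<odot>\<^bsub>M\<^esub> u (Suc n))" if "u n \<in> W" for n
    using someI_ex[of "\<lambda>v. v \<in> W \<and> (\<exists>h\<in>H. u n = h \<oplus>\<^bsub>M\<^esub> a \<odot>\<^bsub>M\<^esub> v)"] div[OF that]
    unfolding u_def by auto
  have uW: "u n \<in> W" for n
    by (induction n) (use u_Suc \<open>w \<in> W\<close> in \<open>auto simp: u_def\<close>)
  have uc: "u n \<in> carrier M" for n using uW W by blast
  let ?R = "\<lambda>n. {r \<odot>\<^bsub>M\<^esub> u n | r. r \<in> carrier R}"
  let ?C = "\<lambda>n. H <+>\<^bsub>M\<^esub> ?R n"
  have C: "submodule (?C n) R M" for n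
    using submodule_set_add[OF assms(3) submodule_cyclic[OF uc]] .
  have u_in_C: "u n \<in> ?C n" for n
  proof -
    have "u n \<in> ?R n"
      using uc smult_one R.one_closed by (metis (mono_tags, lifting) mem_Collect_eq)
    then show ?thesis
      using set_add_upper(2)[OF assms(3) submodule_cyclic[OF uc]] by blast
  qed
  have "?C n \<subseteq> ?C (Suc n)" for n
  proof
    fix y assume "y \<in> ?C n"
    then obtain h r where hr: "h \<in> H" "r \<in> carrier R" "y = h \<oplus>\<^bsub>M\<^esub> r \<odot>\<^bsub>M\<^esub> u n"
      unfolding mem_set_add_iff by blast
    obtain h' where h': "h' \<in> H" "u n = h' \<oplus>\<^bsub>M\<^esub> a \<odot>\<^bsub>M\<^esub> u (Suc n)"
      using u_Suc[OF uW] by blast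
    have "h' \<in> ?C (Suc n)" "h \<in> ?C (Suc n)"
      using set_add_upper(1)[OF assms(3) submodule_cyclic[OF uc]] h' hr by blast+
    moreover have "a \<odot>\<^bsub>M\<^esub> u (Suc n) \<in> ?C (Suc n)"
      using submoduleE(4)[OF C] assms(4) u_in_C by blast
    ultimately have "u n \<in> ?C (Suc n)" "h \<in> ?C (Suc n)"
      unfolding h'(2) using submoduleE(5)[OF C] by blast+
    then show "y \<in> ?C (Suc n)"
      unfolding hr(3) using submoduleE(4,5)[OF C] hr(2) by blast
  qed
  then have "mono ?C" by (rule mono_iff_le_Suc[THEN iffD2, rule_format])
  then obtain n where n: "\<And>m. m \<ge> n \<Longrightarrow> ?C m = ?C n"
    using fg_module_ascending_submodules_stabilize[OF assms(1,2), of ?C] C by blast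
  \<comment> \<open>Stationarity yields \<open>u (Suc n) = h + r (u n)\<close>. Substituting
    \<open>u n = h' + a (u (Suc n))\<close> gives \<open>(1 - ra) u (Suc n) = h + rh'\<close>, which
    is in \<open>H\<close>, and \<open>1 - ra\<close> can be cancelled as a unit.\<close>
  have "u (Suc n) \<in> H"
  proof -
    let ?v = "u (Suc n)"
    have "?v \<in> ?C n" using u_in_C[of "Suc n"] n[of "Suc n"] by simp
    then obtain h r where hr: "h \<in> H" "r \<in> carrier R" "?v = h \<oplus>\<^bsub>M\<^esub> r \<odot>\<^bsub>M\<^esub> u n"
      unfolding mem_set_add_iff by blast
    obtain h' where h': "h' \<in> H" "u n = h' \<oplus>\<^bsub>M\<^esub> a \<odot>\<^bsub>M\<^esub> ?v"
      using u_Suc[OF uW] by blast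
    define s where "s = \<one> \<ominus> r \<otimes> a"
    define k where "k = h \<oplus>\<^bsub>M\<^esub> r \<odot>\<^bsub>M\<^esub> h'"
    have s: "s \<in> Units R" "s \<in> carrier R" using unit hr unfolding s_def by auto
    have k: "k \<in> H" unfolding k_def using H hr h' by blast
    have c: "h \<in> carrier M" "h' \<in> carrier M" "k \<in> carrier M" "?v \<in> carrier M"
      using hr h' k Hc uc by blast+
    have "r \<odot>\<^bsub>M\<^esub> u n = r \<odot>\<^bsub>M\<^esub> h' \<oplus>\<^bsub>M\<^esub> (r \<otimes> a) \<odot>\<^bsub>M\<^esub> ?v"
      unfolding h'(2) using c hr(2) assms(4) by (simp add: smult_r_distr smult_assoc1)
    then have v: "?v = k \<oplus>\<^bsub>M\<^esub> (r \<otimes> a) \<odot>\<^bsub>M\<^esub> ?v"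
      using hr(2,3) c assms(4) unfolding k_def by (simp add: M.a_assoc)
    have "k \<oplus>\<^bsub>M\<^esub> (r \<otimes> a) \<odot>\<^bsub>M\<^esub> ?v \<ominus>\<^bsub>M\<^esub> (r \<otimes> a) \<odot>\<^bsub>M\<^esub> ?v = k"
      using c hr(2) assms(4) by (simp add: a_minus_def M.a_assoc M.r_neg)
    then have "?v \<ominus>\<^bsub>M\<^esub> (r \<otimes> a) \<odot>\<^bsub>M\<^esub> ?v = k"
      by (simp flip: v)
    moreover have "s \<odot>\<^bsub>M\<^esub> ?v = ?v \<ominus>\<^bsub>M\<^esub> (r \<otimes> a) \<odot>\<^bsub>M\<^esub> ?v"
      unfolding s_def a_minus_def using c(4) hr(2) assms(4)
      by (simp add: smult_l_distr smult_l_minus)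
    ultimately have "s \<odot>\<^bsub>M\<^esub> ?v \<in> H" using k by simp
    then have "inv s \<odot>\<^bsub>M\<^esub> (s \<odot>\<^bsub>M\<^esub> ?v) \<in> H" using H(4) s by blast
    then show ?thesis using s uc by (simp flip: smult_assoc1)
  qed
  \<comment> \<open>Membership in \<open>H\<close> descends along
    \<open>u i = h + a (u (Suc i))\<close> until it reaches \<open>u 0 = w\<close>.\<close>
  moreover have step: "u i \<in> H" if "u (Suc i) \<in> H" for i
    using u_Suc[OF uW, of i] that H(4,5) assms(4) by metis
  moreover have "u i \<in> H \<Longrightarrow> u 0 \<in> H" for i
    by (induction i) (use step in auto)
  ultimately have "u 0 \<in> H" by blast
  then show "w \<in> H" by (simp add: u_def)
qed

text \<open>
  Let \<open>W\<close> consist of the elements which \<open>P\<close> maps into \<open>H\<close>.  As \<open>a\<close> is regular modulo \<open>H\<close>,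
  \<open>W \<subseteq> H + aM\<close> would give \<open>W = H + aW\<close> and hence \<open>W = H\<close>.
\<close>
lemma exists_larger_prime_colon:
  assumes "noetherian_ring R" "fg_module R M" "submodule H R M" "a \<in> carrier R"
    and unit: "\<And>r. r \<in> carrier R \<Longrightarrow> \<one> \<ominus> r \<otimes> a \<in> Units R"
    and reg: "\<And>y. \<lbrakk>y \<in> carrier M; a \<odot>\<^bsub>M\<^esub> y \<in> H\<rbrakk> \<Longrightarrow> y \<in> H"
    and x: "x \<in> carrier M" and prime: "primeideal (colon R M H x) R"
  defines "K \<equiv> H <+>\<^bsub>M\<^esub> (\<odot>\<^bsub>M\<^esub>) a ` carrier M"
  shows "\<exists>z\<in>carrier M. colon R M H x \<subset> colon R M K z \<and> primeideal (colon R M K z) R"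
proof -
  interpret P: primeideal "colon R M H x" R by fact
  note H = submoduleE[OF assms(3)]
  have Hc: "h \<in> H \<Longrightarrow> h \<in> carrier M" for h using H(1) by blast
  note aM = submodule_smult_image[OF assms(4)]
  have K: "submodule K R M"
    unfolding K_def using submodule_set_add assms(3) aM by blast
  have HK: "H \<subseteq> K" and aK: "\<And>y. y \<in> carrier M \<Longrightarrow> a \<odot>\<^bsub>M\<^esub> y \<in> K"
    unfolding K_def using set_add_upper[OF assms(3) aM] by blast+
  have xH: "x \<notin> H"
  proof
    assume "x \<in> H"
    then have "\<one> \<in> colon R M H x" using x by (simp add: mem_colon_iff)
    then show False using P.one_imp_carrier P.I_notcarr by simp
  qed
  define W where "W = {w \<in> carrier M. \<forall>p\<in>colon R M H x. p \<odot>\<^bsub>M\<^esub> w \<in> H}"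
  have "x \<in> W" unfolding W_def using x by (auto simp: mem_colon_iff)
  have "\<not> W \<subseteq> K"
  proof
    assume WK: "W \<subseteq> K"
    have "\<exists>h\<in>H. \<exists>v\<in>W. w = h \<oplus>\<^bsub>M\<^esub> a \<odot>\<^bsub>M\<^esub> v" if w: "w \<in> W" for w
    proof -
      obtain h v where hv: "h \<in> H" "v \<in> carrier M" "w = h \<oplus>\<^bsub>M\<^esub> a \<odot>\<^bsub>M\<^esub> v"
        using subsetD[OF WK w] by (auto simp: K_def mem_set_add_iff)
      \<comment> \<open>This shows that \<open>v\<close> is again in \<open>W\<close>:
        \<open>a(pv) = pw - ph\<close> lies in \<open>H\<close>, and regularity of \<open>a\<close>
        modulo \<open>H\<close> removes the factor \<open>a\<close>.\<close>
      have "p \<odot>\<^bsub>M\<^esub> v \<in> H" if p: "p \<in> colon R M H x" for p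
      proof -
        have pR: "p \<in> carrier R" using p by (simp add: mem_colon_iff)
        have "p \<odot>\<^bsub>M\<^esub> w \<in> H" using w p unfolding W_def by blast
        moreover have "p \<odot>\<^bsub>M\<^esub> h \<in> H" using H(4) pR hv by blast
        ultimately have "p \<odot>\<^bsub>M\<^esub> w \<ominus>\<^bsub>M\<^esub> p \<odot>\<^bsub>M\<^esub> h \<in> H"
          by (rule submodule_minus_closed[OF assms(3)])
        moreover have "p \<odot>\<^bsub>M\<^esub> w \<ominus>\<^bsub>M\<^esub> p \<odot>\<^bsub>M\<^esub> h = p \<odot>\<^bsub>M\<^esub> (a \<odot>\<^bsub>M\<^esub> v)"
          unfolding hv(3) using hv Hc pR assms(4)
          by (simp add: smult_r_distr a_minus_def M.a_comm[of "p \<odot>\<^bsub>M\<^esub> h"] M.a_assoc M.r_neg)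
        ultimately have "a \<odot>\<^bsub>M\<^esub> (p \<odot>\<^bsub>M\<^esub> v) \<in> H"
          using smult_left_commute[OF pR assms(4) hv(2)] by simp
        then show ?thesis using reg pR hv(2) by simp
      qed
      then show ?thesis using hv unfolding W_def by blast
    qed
    then have "W \<subseteq> H"
      using divisible_subset_submodule[OF assms(1-4) unit, of W] unfolding W_def by blast
    then show False using \<open>x \<in> W\<close> xH by blast
  qed
  then obtain y where y: "y \<in> W" "y \<notin> K" by blast
  then have yc: "y \<in> carrier M" unfolding W_def by blast
  obtain z where z: "z \<in> carrier M" "colon R M K y \<subseteq> colon R M K z"
      "primeideal (colon R M K z) R"
    using exists_prime_colon[OF assms(1) K yc y(2)] by blast
  \<comment> \<open>The inclusion comes from \<open>y\<close> in \<open>W\<close> and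
    \<open>H\<close> inside \<open>K\<close>. It is strict because of \<open>a\<close>: it sends
    \<open>y\<close> into \<open>K\<close>, whereas \<open>ax\<close> in \<open>H\<close> would
    force \<open>x\<close> into \<open>H\<close>.\<close>
  have "colon R M H x \<subseteq> colon R M K y"
    using y(1) HK P.a_subset unfolding W_def by (auto simp: mem_colon_iff)
  moreover have "a \<in> colon R M K y" using assms(4) aK yc by (simp add: mem_colon_iff)
  moreover have "a \<notin> colon R M H x" using reg[OF x] xH mem_colon_iff by blast
  ultimately show ?thesis using z by blast
qed

section \<open>Regular sequences\<close>

text \<open>The coset of \<open>y\<close> is killed by \<open>a\<close>, so it is the zero coset
  \<open>H\<close>. This carries regularity from the quotient module back to submodules of
  \<open>M\<close>.\<close>

lemma quot_module_nonzerodivisorD: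
  assumes "submodule H R M" "a \<in> carrier R"
    and reg: "module_nonzerodivisor (quot_module M H) a"
    and y: "y \<in> carrier M" "a \<odot>\<^bsub>M\<^esub> y \<in> H"
  shows "y \<in> H"
proof -
  note H = submoduleE[OF assms(1)]
  have Hc: "h \<in> H \<Longrightarrow> h \<in> carrier M" for h using H(1) by blast
  interpret H: abelian_subgroup H M
    using assms(1) M.abelian_group_axioms
    by (auto intro!: abelian_subgroupI3 additive_subgroupI simp: submodule_def)
  let ?C = "H +>\<^bsub>M\<^esub> y"
  \<comment> \<open>Scalar multiplication in the quotient is a union over all representatives
    \<open>z\<close> of the coset. Each of them contributes \<open>H\<close>, and \<open>y\<close>
    itself shows that the union is not empty.\<close>
  have "H +>\<^bsub>M\<^esub> (a \<odot>\<^bsub>M\<^esub> z) = H" if "z \<in> ?C" for z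
  proof -
    obtain h where h: "h \<in> H" "z = h \<oplus>\<^bsub>M\<^esub> y" using \<open>z \<in> ?C\<close> by (auto simp: a_r_coset_def')
    then have "a \<odot>\<^bsub>M\<^esub> z = a \<odot>\<^bsub>M\<^esub> h \<oplus>\<^bsub>M\<^esub> a \<odot>\<^bsub>M\<^esub> y"
      using Hc y assms(2) by (simp add: smult_r_distr)
    then have "a \<odot>\<^bsub>M\<^esub> z \<in> H" using H(4,5) h y assms(2) by simp
    then show ?thesis by (rule H.a_rcos_const)
  qed
  moreover have yC: "y \<in> ?C" using H.a_rcos_self y by blast
  ultimately have "(\<Union>z\<in>?C. H +>\<^bsub>M\<^esub> (a \<odot>\<^bsub>M\<^esub> z)) = H" by blast
  then have "a \<odot>\<^bsub>quot_module M H\<^esub> ?C = \<zero>\<^bsub>quot_module M H\<^esub>"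
    by (simp add: quot_module_def)
  moreover have "?C \<in> carrier (quot_module M H)"
    using y by (auto simp: quot_module_def A_RCOSETS_def')
  ultimately have "?C = H"
    using reg by (auto simp: module_nonzerodivisor_def quot_module_def)
  then show ?thesis using yC by simp
qed

lemma submodule_ideal_smult:
  assumes "I \<subseteq> carrier R"
  shows "submodule (ideal_smult R M I) R M"
  unfolding ideal_smult_def using assms by (intro submodule_gen_submodule) auto

lemma smult_in_ideal_smult: "\<lbrakk>a \<in> I; x \<in> carrier M\<rbrakk> \<Longrightarrow> a \<odot>\<^bsub>M\<^esub> x \<in> ideal_smult R M I"
  unfolding ideal_smult_def by (rule subsetD[OF gen_submodule_self]) auto

text \<open>The scalars that map all of \<open>M\<close> into \<open>H\<close> form an ideal, so it
  is enough to test the generators in \<open>S\<close>.\<close>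

lemma ideal_smult_genideal_minimal:
  assumes "S \<subseteq> carrier R" "submodule H R M"
    and S: "\<And>s x. \<lbrakk>s \<in> S; x \<in> carrier M\<rbrakk> \<Longrightarrow> s \<odot>\<^bsub>M\<^esub> x \<in> H"
  shows "ideal_smult R M (Idl S) \<subseteq> H"
proof -
  note H = submoduleE[OF assms(2)]
  have "ideal {r \<in> carrier R. \<forall>x\<in>carrier M. r \<odot>\<^bsub>M\<^esub> x \<in> H} R"
    using H submodule_zero_closed[OF assms(2)]
    by (intro R.idealI_closed) (auto simp: smult_l_distr smult_assoc1)
  then have "Idl S \<subseteq> {r \<in> carrier R. \<forall>x\<in>carrier M. r \<odot>\<^bsub>M\<^esub> x \<in> H}"
    using assms(1) S by (intro R.genideal_minimal) auto
  then show ?thesis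
    unfolding ideal_smult_def using assms(2) by (intro gen_submodule_minimal) auto
qed

lemma ideal_smult_empty: "ideal_smult R M (Idl {}) = {\<zero>\<^bsub>M\<^esub>}"
  using ideal_smult_genideal_minimal[OF _ submodule_zero, of "{}"]
    submodule_zero_closed[OF submodule_ideal_smult]
    ideal.Icarr[OF R.genideal_ideal[of "{}"]] by blast

text \<open>Both inclusions are checked on generators. The right-hand side has the shape of
  \<open>K\<close> in \<open>exists_larger_prime_colon\<close>, which allows a regular sequence to
  be treated one element at a time.\<close>

lemma ideal_smult_insert:
  assumes "S \<subseteq> carrier R" "a \<in> carrier R"
  shows "ideal_smult R M (Idl (insert a S)) =
    ideal_smult R M (Idl S) <+>\<^bsub>M\<^esub> (\<odot>\<^bsub>M\<^esub>) a ` carrier M" (is "?L = ?H <+>\<^bsub>M\<^esub> ?A")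
proof
  have sub: "Idl T \<subseteq> carrier R" if "T \<subseteq> carrier R" for T
    using ideal.Icarr[OF R.genideal_ideal[OF that]] by blast
  note H = submodule_ideal_smult[OF sub[OF assms(1)]]
  note A = submodule_smult_image[OF assms(2)]
  have aS: "insert a S \<subseteq> carrier R" using assms by blast
  have self: "s \<in> T \<Longrightarrow> T \<subseteq> carrier R \<Longrightarrow> s \<in> Idl T" for s T
    using subsetD[OF R.genideal_self] by simp
  show "?L \<subseteq> ?H <+>\<^bsub>M\<^esub> ?A"
  proof (rule ideal_smult_genideal_minimal[OF aS submodule_set_add[OF H A]])
    show "s \<odot>\<^bsub>M\<^esub> x \<in> ?H <+>\<^bsub>M\<^esub> ?A" if "s \<in> insert a S" "x \<in> carrier M" for s x
      using that set_add_upper[OF H A] smult_in_ideal_smult[OF self[OF _ assms(1)]] by blast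
  qed
  note L = submodule_ideal_smult[OF sub[OF aS]]
  have mem: "s \<odot>\<^bsub>M\<^esub> x \<in> ?L" if "s \<in> insert a S" "x \<in> carrier M" for s x
    using smult_in_ideal_smult[OF self[OF that(1) aS] that(2)] .
  have "?H \<subseteq> ?L"
    by (rule ideal_smult_genideal_minimal[OF assms(1) L]) (simp add: mem)
  moreover have "?A \<subseteq> ?L"
    using mem by auto
  ultimately show "?H <+>\<^bsub>M\<^esub> ?A \<subseteq> ?L"
    using submoduleE(5)[OF L] unfolding set_add_def' by blast
qed

section \<open>Chains of primes from regular sequences and the bound on depth\<close>

lemma Ass_eq_colon: "Ass R M = {P. primeideal P R \<and> (\<exists>x\<in>carrier M. P = colon R M {\<zero>\<^bsub>M\<^esub>} x)}"
  by (simp add: Ass_def colon_def)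

text \<open>Induction on \<open>k\<close> by \<open>exists_larger_prime_colon\<close>. Recording
  that the top prime \<open>Q k\<close> is a colon ideal of the submodule generated by the first
  \<open>k\<close> elements is what allows the next step.\<close>

lemma regular_sequence_prime_chain:
  assumes "noetherian_ring R" "local_ring R J" "fg_module R M"
    and "set xs \<subseteq> J" "regular_sequence R M xs" "P \<in> Ass R M" "k \<le> length xs"
  shows "\<exists>Q. Q 0 = P \<and> (\<forall>i\<le>k. primeideal (Q i) R) \<and> (\<forall>i<k. Q i \<subset> Q (Suc i)) \<and>
    (\<exists>x\<in>carrier M. Q k = colon R M (ideal_smult R M (Idl (set (take k xs)))) x)"
  using assms(7)
proof (induction k)
  case 0
  then show ?case
    \<comment> \<open>With no element taken the submodule is zero, and \<open>P\<close> is a colon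
      ideal of it because it is associated to \<open>M\<close>.\<close>
    using assms(6) by (intro exI[of _ "\<lambda>_. P"]) (auto simp: Ass_eq_colon ideal_smult_empty)
next
  case (Suc k)
  interpret noetherian_ring R by fact
  interpret J: maximalideal J R using assms(2) unfolding local_ring_def by blast
  let ?S = "set (take k xs)" and ?a = "xs ! k"
  let ?H = "ideal_smult R M (Idl ?S)"
  from Suc obtain Q x where Q: "Q 0 = P" "\<forall>i\<le>k. primeideal (Q i) R" "\<forall>i<k. Q i \<subset> Q (Suc i)"
    and x: "x \<in> carrier M" "Q k = colon R M ?H x" by auto
  have k: "k < length xs" using Suc.prems by simp
  have S: "?S \<subseteq> carrier R" "?a \<in> carrier R" and aJ: "?a \<in> J"
    using assms(4) J.a_subset k set_take_subset[of k xs] nth_mem[OF k] by blast+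
  have H: "submodule ?H R M"
    using ideal.Icarr[OF R.genideal_ideal[OF S(1)]] by (intro submodule_ideal_smult) blast
  have "module_nonzerodivisor (quot_module M ?H) ?a"
    using assms(5) k unfolding regular_sequence_def by blast
  then have reg: "y \<in> ?H" if "y \<in> carrier M" "?a \<odot>\<^bsub>M\<^esub> y \<in> ?H" for y
    using quot_module_nonzerodivisorD[OF H S(2)] that by blast
  \<comment> \<open>Here locality enters: \<open>?a\<close> lies in the maximal ideal
    \<open>J\<close>, hence so does each of its multiples.\<close>
  have unit: "\<one> \<ominus> r \<otimes> ?a \<in> Units R" if "r \<in> carrier R" for r
    using local_ring_one_minus_Units[OF assms(2)] J.I_l_closed[OF aJ that] by blast
  have "primeideal (colon R M ?H x) R" using Q(2) x(2) by auto
  from exists_larger_prime_colon[OF assms(1,3) H S(2) unit reg x(1) this]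
  obtain z where z: "z \<in> carrier M"
      "colon R M ?H x \<subset> colon R M (?H <+>\<^bsub>M\<^esub> (\<odot>\<^bsub>M\<^esub>) ?a ` carrier M) z"
      "primeideal (colon R M (?H <+>\<^bsub>M\<^esub> (\<odot>\<^bsub>M\<^esub>) ?a ` carrier M) z) R"
    by blast
  moreover have "?H <+>\<^bsub>M\<^esub> (\<odot>\<^bsub>M\<^esub>) ?a ` carrier M =
      ideal_smult R M (Idl (set (take (Suc k) xs)))"
    using ideal_smult_insert[OF S] k by (simp add: take_Suc_conv_app_nth)
  ultimately obtain Q' where Q': "Q k \<subset> Q'" "primeideal Q' R"
      "Q' = colon R M (ideal_smult R M (Idl (set (take (Suc k) xs)))) z"
    using x(2) by metis
  show ?case
    by (rule exI[of _ "Q(Suc k := Q')"]) (use Q Q' z(1) in \<open>auto simp: le_Suc_eq less_Suc_eq\<close>)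
qed

lemma regular_sequence_length_le_coht:
  assumes "noetherian_ring R" "local_ring R J" "fg_module R M"
    and "set xs \<subseteq> J" "regular_sequence R M xs" "P \<in> Ass R M"
  shows "enat (length xs) \<le> coht R P"
proof -
  obtain Q where "Q 0 = P" "\<forall>i\<le>length xs. primeideal (Q i) R"
      "\<forall>i<length xs. Q i \<subset> Q (Suc i)"
    using regular_sequence_prime_chain[OF assms order_refl] by blast
  then show ?thesis
    using R.coht_ge_chain_length[of "length xs" Q] by simp
qed

text \<open>Every colon ideal of the zero module is the whole ring, which is not prime.\<close>

lemma Ass_zero_module:
  assumes "zero_module M"
  shows "Ass R M = {}"
proof -
  have False if "primeideal (colon R M {\<zero>\<^bsub>M\<^esub>} x) R" "x \<in> carrier M" for x
    using that assms primeideal.I_notcarr[OF that(1)]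
    by (auto simp: zero_module_def colon_def)
  then show ?thesis by (auto simp: Ass_eq_colon)
qed

text \<open>Both sides are \<infinity>: the depth by convention, the initial dimension as the
  infimum of the empty set.\<close>

lemma depth_eq_indim_zero_module:
  assumes "zero_module M"
  shows "depth R J M = indim R M"
  using assms by (simp add: depth_def indim_def Ass_zero_module top_enat_def)

lemma depth_le_indim:
  assumes "noetherian_ring R" "local_ring R J" "fg_module R M"
  shows "depth R J M \<le> indim R M"
proof (cases "zero_module M")
  case True
  then show ?thesis
    by (simp add: depth_eq_indim_zero_module)
next
  case False
  then show ?thesis
    \<comment> \<open>The length of every regular sequence bounds the coheight of every associated
      prime from below, so the supremum is at most the infimum.\<close>
    unfolding depth_def indim_def
    using regular_sequence_length_le_coht[OF assms] by (auto intro!: Sup_least Inf_greatest)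
qed

end

theorem theorem1p1:
  fixes R :: "('a, 'r) ring_scheme" and M :: "'a set" and N :: "('a, 'b, 'm) module_scheme"
  assumes "noetherian_ring R" and "local_ring R M"
    and "module R N" and "fg_module R N"
  shows "depth R M N \<le> indim R N \<and>
    (depth R M N = indim R N \<longleftrightarrow> initially_Cohen_Macaulay R M N)"
proof -
  interpret module R N by fact
  show ?thesis
    \<comment> \<open>For nonzero \<open>N\<close> the equivalence is the definition; for zero
      \<open>N\<close> both of its sides hold.\<close>
    using depth_le_indim[OF assms(1,2,4)] depth_eq_indim_zero_module
    by (auto simp: initially_Cohen_Macaulay_def)
qed

end
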